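(* Let $1\le p<\infty$, let $X,Y$ be Banach spaces and let $\Omega$ be a dispersed compact Hausdorff space. (i) Let $T:C(\Omega,X)\to Y$ be a strongly bounded operator with representing measure $m:\Sigma\to L(X,Y)$. Then $T^*$ is Dunford-Pettis $p$-convergent if and only if $m(A)^*:Y^*\to X^*$ is Dunford-Pettis $p$-convergent for each $A\in\Sigma$. (ii) Let $T:C(\Omega,X)\to Y^*$ be a strongly bounded operator with representing measure $m:\Sigma\to L(X,Y^* )$. Then $T^*|_Y:Y\to C(\Omega,X)^*$ is Dunford-Pettis $p$-convergent if and only if $m(A)^*|_Y:Y\to X^*$ is Dunford-Pettis $p$-convergent for each $A\in\Sigma$.
   Context: A topological space is dispersed (scattered) if every nonempty closed subset has an isolated point. A sequence $(x_n)_n$ in a Banach space $X$ is weakly $p$-summable if $(x^*(x_n))_n\in\ell_p$ for every $x^*\in X^*$. A bounded set $K\subseteq X$ is a Dunford-Pettis set if every weakly null sequence $(x_n^* )_n$ in $X^*$ converges to $0$ uniformly on $K$. A bounded linear operator between Banach spaces is Dunford-Pettis $p$-convergent if it takes every weakly $p$-summable sequence whose set of terms is a Dunford-Pettis set to a norm null sequence. $C(\Omega,X)$ is the space of continuous functions $\Omega\to X$ with the supremum norm; $\Sigma$ is the $\sigma$-algebra of Borel subsets of $\Omega$. Every bounded linear operator $T:C(\Omega,X)\to Z$ ($Z$ a Banach space) has a representing measure $m:\Sigma\to L(X,Z^{**})$ of finite semivariation $\tilde m$ with $T(f)=\int_\Omega f\,dm$, where $\tilde m(A)=\sup\|\sum_i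 m(A_i)x_i\|$ over finite Borel partitions $(A_i)$ of $A$ and $x_i$ in the unit ball of $X$. $T$ is strongly bounded if $m$ is, i.e. $\tilde m(A_n)\to0$ for every pairwise disjoint sequence $(A_n)$ in $\Sigma$; in this case $m$ takes values in $L(X,Z)$. $Y$ is regarded as a subspace of $Y^{**}$ canonically. *)

theory Defs
  imports "HOL-Analysis.Analysis"
begin

section \<open>Duality for normed spaces\<close>

text \<open>The dual of \<open>'a\<close> is the type \<open>'a \<Rightarrow>\<^sub>L real\<close>.\<close>

definition dual_operator ::
    "('a::real_normed_vector \<Rightarrow>\<^sub>L 'b::real_normed_vector) \<Rightarrow> ('b \<Rightarrow>\<^sub>L real) \<Rightarrow>\<^sub>L ('a \<Rightarrow>\<^sub>L real)"
  where "dual_operator T = Blinfun (\<lambda>\<phi>. \<phi> o\<^sub>L T)"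

definition bidual_embedding ::
    "'a::real_normed_vector \<Rightarrow>\<^sub>L (('a \<Rightarrow>\<^sub>L real) \<Rightarrow>\<^sub>L real)"
  where "bidual_embedding = Blinfun (\<lambda>x. Blinfun (\<lambda>\<phi>. blinfun_apply \<phi> x))"

lemma dual_operator_apply [simp]: "blinfun_apply (dual_operator T) \<phi> = \<phi> o\<^sub>L T"
  unfolding dual_operator_def
  by (simp add: bounded_linear_Blinfun_apply
      bounded_bilinear.bounded_linear_left[OF bounded_bilinear_blinfun_compose])

lemma bidual_embedding_apply [simp]:
  "blinfun_apply (blinfun_apply bidual_embedding x) \<phi> = blinfun_apply \<phi> x"
proof -
  have ev: "blinfun_apply (Blinfun (\<lambda>\<phi>. blinfun_apply \<phi> y)) \<psi> = blinfun_apply \<psi> y"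
    for y :: 'a and \<psi> :: "'a \<Rightarrow>\<^sub>L real"
    by (simp add: bounded_linear_Blinfun_apply
        bounded_bilinear.bounded_linear_left[OF bounded_bilinear_blinfun_apply])
  have "bounded_linear (\<lambda>y::'a. Blinfun (\<lambda>\<phi>::'a \<Rightarrow>\<^sub>L real. blinfun_apply \<phi> y))"
  proof (rule bounded_linear_intro[where K = 1])
    fix y :: 'a
    show "norm (Blinfun (\<lambda>\<phi>::'a \<Rightarrow>\<^sub>L real. blinfun_apply \<phi> y)) \<le> norm y * 1"
      by (rule norm_blinfun_bound) (simp_all only: ev mult_1_right norm_ge_zero mult.commute[of "norm y"] norm_blinfun)
  qed (rule blinfun_eqI, simp only: ev plus_blinfun.rep_eq scaleR_blinfun.rep_eq,
      rule blinfun.add_right blinfun.scaleR_right)+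
  then show ?thesis
    unfolding bidual_embedding_def by (simp add: bounded_linear_Blinfun_apply ev)
qed


section \<open>Dunford-Pettis p-convergent operators\<close>

definition weakly_p_summable :: "real \<Rightarrow> (nat \<Rightarrow> 'a::real_normed_vector) \<Rightarrow> bool"
  where "weakly_p_summable p x \<longleftrightarrow>
    (\<forall>\<phi> :: 'a \<Rightarrow>\<^sub>L real. summable (\<lambda>n. \<bar>blinfun_apply \<phi> (x n)\<bar> powr p))"

definition weakly_null :: "(nat \<Rightarrow> 'a::real_normed_vector) \<Rightarrow> bool"
  where "weakly_null x \<longleftrightarrow> (\<forall>\<phi> :: 'a \<Rightarrow>\<^sub>L real. (\<lambda>n. blinfun_apply \<phi> (x n)) \<longlonglongrightarrow> 0)"

definition Dunford_Pettis_set :: "'a::real_normed_vector set \<Rightarrow> bool"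
  where "Dunford_Pettis_set K \<longleftrightarrow> bounded K \<and>
    (\<forall>\<phi> :: nat \<Rightarrow> 'a \<Rightarrow>\<^sub>L real. weakly_null \<phi> \<longrightarrow>
       uniform_limit K (\<lambda>n x. blinfun_apply (\<phi> n) x) (\<lambda>_. 0) sequentially)"

definition Dunford_Pettis_p_convergent ::
    "real \<Rightarrow> ('a::real_normed_vector \<Rightarrow>\<^sub>L 'b::real_normed_vector) \<Rightarrow> bool"
  where "Dunford_Pettis_p_convergent p S \<longleftrightarrow>
    (\<forall>x :: nat \<Rightarrow> 'a. weakly_p_summable p x \<and> Dunford_Pettis_set (range x) \<longrightarrow>
       (\<lambda>n. norm (blinfun_apply S (x n))) \<longlonglongrightarrow> 0)"


section \<open>Dispersed spaces\<close>

definition dispersed :: "'o::topological_space itself \<Rightarrow> bool"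
  where "dispersed _ \<longleftrightarrow> (\<forall>C :: 'o set. closed C \<and> C \<noteq> {} \<longrightarrow> (\<exists>x. x isolated_in C))"


section \<open>Vector measures on the Borel sets\<close>

text \<open>A set function on the Borel \<open>\<sigma>\<close>-algebra is a function on all of \<open>'o set\<close>; only its values
  on \<open>sets borel\<close> are ever used.\<close>

definition borel_partition :: "'o::topological_space set \<Rightarrow> 'o set set \<Rightarrow> bool"
  where "borel_partition A P \<longleftrightarrow> finite P \<and> P \<subseteq> sets borel \<and> partition_on A P"

definition finitely_additive_vm :: "('o::topological_space set \<Rightarrow> 'v::real_normed_vector) \<Rightarrow> bool"
  where "finitely_additive_vm \<mu> \<longleftrightarrow>
    (\<forall>A \<in> sets borel. \<forall>B \<in> sets borel. A \<inter> B = {} \<longrightarrow> \<mu> (A \<union> B) = \<mu> A + \<mu> B)"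

definition countably_additive_vm :: "('o::topological_space set \<Rightarrow> 'v::real_normed_vector) \<Rightarrow> bool"
  where "countably_additive_vm \<mu> \<longleftrightarrow>
    (\<forall>A :: nat \<Rightarrow> 'o set. range A \<subseteq> sets borel \<and> disjoint_family A \<longrightarrow>
       (\<lambda>n. \<mu> (A n)) sums \<mu> (\<Union>n. A n))"

definition variation ::
    "('o::topological_space set \<Rightarrow> 'v::real_normed_vector) \<Rightarrow> 'o set \<Rightarrow> ennreal"
  where "variation \<mu> A = (SUP P \<in> {P. borel_partition A P}. \<Sum>B\<in>P. ennreal (norm (\<mu> B)))"

definition semivariation ::
    "('o::topological_space set \<Rightarrow> 'x::real_normed_vector \<Rightarrow>\<^sub>L 'z::real_normed_vector) \<Rightarrow>
      'o set \<Rightarrow> ennreal"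
  where "semivariation m A =
    (SUP (P, x) \<in> {(P, x :: 'o set \<Rightarrow> 'x). borel_partition A P \<and> (\<forall>B\<in>P. norm (x B) \<le> 1)}.
       ennreal (norm (\<Sum>B\<in>P. blinfun_apply (m B) (x B))))"

definition strongly_bounded ::
    "('o::topological_space set \<Rightarrow> 'x::real_normed_vector \<Rightarrow>\<^sub>L 'z::real_normed_vector) \<Rightarrow> bool"
  where "strongly_bounded m \<longleftrightarrow>
    (\<forall>A :: nat \<Rightarrow> 'o set. range A \<subseteq> sets borel \<and> disjoint_family A \<longrightarrow>
       (\<lambda>n. semivariation m (A n)) \<longlonglongrightarrow> 0)"

definition regular_vm :: "('o::topological_space set \<Rightarrow> 'v::real_normed_vector) \<Rightarrow> bool"
  where "regular_vm \<mu> \<longleftrightarrow>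
    (\<forall>A \<in> sets borel. \<forall>\<epsilon> > 0. \<exists>K U. compact K \<and> open U \<and> K \<subseteq> A \<and> A \<subseteq> U \<and>
       variation \<mu> (U - K) < ennreal \<epsilon>)"

definition rcabv :: "('o::topological_space set \<Rightarrow> 'v::real_normed_vector) \<Rightarrow> bool"
  where "rcabv \<mu> \<longleftrightarrow> countably_additive_vm \<mu> \<and> variation \<mu> UNIV < \<infinity> \<and> regular_vm \<mu>"

text \<open>The integral of a uniform limit of Borel simple functions; \<open>vm_simple_integral\<close> is
  \<open>\<Sum>\<^sub>i m(A\<^sub>i) x\<^sub>i\<close> for the canonical form of a simple function.\<close>

definition vm_simple_integral ::
    "('o::topological_space set \<Rightarrow> 'x::real_normed_vector \<Rightarrow>\<^sub>L 'z::real_normed_vector) \<Rightarrow>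
      ('o \<Rightarrow> 'x) \<Rightarrow> 'z"
  where "vm_simple_integral m s = (\<Sum>x\<in>range s. blinfun_apply (m (s -` {x})) x)"

definition vm_has_integral ::
    "('o::topological_space set \<Rightarrow> 'x::real_normed_vector \<Rightarrow>\<^sub>L 'z::real_normed_vector) \<Rightarrow>
      ('o \<Rightarrow> 'x) \<Rightarrow> 'z \<Rightarrow> bool"
  where "vm_has_integral m f I \<longleftrightarrow>
    (\<exists>s :: nat \<Rightarrow> 'o \<Rightarrow> 'x. (\<forall>n. simple_function borel (s n)) \<and>
       uniform_limit UNIV s f sequentially \<and>
       (\<lambda>n. vm_simple_integral m (s n)) \<longlonglongrightarrow> I)"

text \<open>A measure \<open>m : \<Sigma> \<rightarrow> L(X, Z)\<close> represents \<open>T\<close> if \<open>A \<mapsto> bidual_embedding o\<^sub>L m A\<close> does.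

  For \<open>m : \<Sigma> \<rightarrow> L(X, Z\<^sup>*\<^sup>*)\<close> and \<open>z\<close> in \<open>Z\<^sup>*\<close>, the set function
  \<open>A \<mapsto> bidual_embedding z o\<^sub>L m A\<close> is \<open>m\<^sub>z : \<Sigma> \<rightarrow> X\<^sup>*\<close>, \<open>m\<^sub>z(A)(x) = (m(A)x)(z)\<close>.
  Regularity of every \<open>m\<^sub>z\<close> is part of the notion of the representing measure; it is what makes
  \<open>m\<close> unique.  (Without it, even on a dispersed space a countably additive \<open>m\<close> need not be determined
  by \<open>T\<close>: on \<open>[0, \<omega>\<^sub>1]\<close> take the Dieudonne measure and the point mass at \<open>\<omega>\<^sub>1\<close>.)

  For compact \<open>'o\<close>, the type \<open>'o \<Rightarrow>\<^sub>C 'x\<close> of bounded continuous functions is \<open>C(\<Omega>, X)\<close>.\<close>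

definition representing_measure ::
    "(('o::topological_space \<Rightarrow>\<^sub>C 'x::real_normed_vector) \<Rightarrow>\<^sub>L 'z::real_normed_vector) \<Rightarrow>
      ('o set \<Rightarrow> 'x \<Rightarrow>\<^sub>L (('z \<Rightarrow>\<^sub>L real) \<Rightarrow>\<^sub>L real)) \<Rightarrow> bool"
  where "representing_measure T m \<longleftrightarrow>
    finitely_additive_vm m \<and>
    semivariation m UNIV < \<infinity> \<and>
    (\<forall>z :: 'z \<Rightarrow>\<^sub>L real. rcabv (\<lambda>A. blinfun_apply bidual_embedding z o\<^sub>L m A)) \<and>
    (\<forall>f :: 'o \<Rightarrow>\<^sub>C 'x. vm_has_integral m (apply_bcontfun f)
       (blinfun_apply bidual_embedding (blinfun_apply T f)))"

end

theory Submission
  imports Defs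
begin

text \<open>For a functional \<open>z\<close> on the target space, the vector measure \<open>A \<mapsto> z o\<^sub>L m A\<close> represents the
  adjoint value \<open>z o\<^sub>L T\<close>.  It is regular, and a regular measure on a dispersed compact space is
  purely atomic; hence up to arbitrarily small variation it lives on a finite set
  (\<open>dispersed_regular_vm_concentrated\<close>).  Strong boundedness of \<open>m\<close> makes this uniform: for every
  \<open>e > 0\<close> one finite set \<open>F\<close> serves all \<open>z\<close> in a given ball, because otherwise one could pick
  disjoint finite sets of semivariation bounded below
  (\<open>strongly_bounded_uniformly_concentrated\<close>).

  Up to an error proportional to \<open>e\<close>, the integral of \<open>f\<close> against the measure of \<open>z\<close> is therefore
  the finite sum of \<open>z (m {\<omega>} (f \<omega>))\<close> over \<open>\<omega> \<in> F\<close>.  On the one hand this bounds \<open>norm (z o\<^sub>L T)\<close> by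
  the norms of the finitely many \<open>z o\<^sub>L m {\<omega>}\<close>.  On the other hand, a finite sum does not
  distinguish the indicator of a Borel set \<open>A\<close> from a continuous function that agrees with it on \<open>F\<close>,
  which bounds \<open>norm (z o\<^sub>L m A)\<close> by \<open>norm (z o\<^sub>L T)\<close>
  (\<open>adjoint_measure_estimates\<close>).  So for a bounded sequence of functionals \<open>\<zeta> n\<close>, the norms of
  \<open>\<zeta> n o\<^sub>L T\<close> tend to \<open>0\<close> if and only if those of \<open>\<zeta> n o\<^sub>L m A\<close> do for every Borel set \<open>A\<close>
  (\<open>adjoint_tendsto_zero_iff\<close>).  Dunford-Pettis sets are bounded, so both parts of the theorem are
  instances, with \<open>\<zeta> n\<close> the image of the \<open>n\<close>-th term of a test sequence under the identity of
  \<open>Y\<^sup>*\<close> or under the canonical embedding of \<open>Y\<close> into \<open>Y\<^sup>*\<^sup>*\<close>.\<close>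


section \<open>Set functions and their variation\<close>

lemma finite_set_in_borel: "finite F \<Longrightarrow> F \<in> sets (borel :: 'o::t2_space measure)"
  by (simp add: borel_closed finite_imp_closed)

lemma finitely_additive_vm_Un:
  assumes "finitely_additive_vm \<mu>" and "A \<in> sets borel" and "B \<in> sets borel"
    and "A \<inter> B = {}"
  shows "\<mu> (A \<union> B) = \<mu> A + \<mu> B"
  using assms unfolding finitely_additive_vm_def by simp

lemma finitely_additive_vm_empty:
  assumes "finitely_additive_vm \<mu>"
  shows "\<mu> {} = 0"
proof -
  have "\<mu> ({} \<union> {}) = \<mu> {} + \<mu> {}"
    by (rule finitely_additive_vm_Un[OF assms]) simp_all
  then show ?thesis by simp
qed

lemma finitely_additive_vm_blinfun_compose:
  assumes "finitely_additive_vm m"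
  shows "finitely_additive_vm (\<lambda>B. z o\<^sub>L m B)"
  using assms unfolding finitely_additive_vm_def
  by (auto intro!: blinfun_eqI simp: blinfun.add_left blinfun.add_right)

lemma finitely_additive_vm_finite_set:
  fixes \<mu> :: "'o::t2_space set \<Rightarrow> 'v::real_normed_vector"
  assumes "finitely_additive_vm \<mu>" and "finite F"
  shows "\<mu> F = (\<Sum>\<omega>\<in>F. \<mu> {\<omega>})"
  using assms(2)
proof (induction F rule: finite_induct)
  case empty
  then show ?case using finitely_additive_vm_empty[OF assms(1)] by simp
next
  case (insert \<omega> F)
  have "\<mu> ({\<omega>} \<union> F) = \<mu> {\<omega>} + \<mu> F"
    using insert.hyps
    by (intro finitely_additive_vm_Un[OF assms(1)] finite_set_in_borel) auto
  then show ?case using insert by simp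
qed

lemma finitely_additive_vm_split_finite:
  fixes \<mu> :: "'o::t2_space set \<Rightarrow> 'v::real_normed_vector"
  assumes "finitely_additive_vm \<mu>" and "finite F" and "B \<in> sets borel"
  shows "\<mu> B = \<mu> (B - F) + (\<Sum>\<omega>\<in>B \<inter> F. \<mu> {\<omega>})"
proof -
  have fin: "finite (B \<inter> F)" using assms(2) by simp
  have "B - F \<in> sets borel" using assms(3) finite_set_in_borel[OF assms(2)] by blast
  then have "\<mu> ((B - F) \<union> (B \<inter> F)) = \<mu> (B - F) + \<mu> (B \<inter> F)"
    by (rule finitely_additive_vm_Un[OF assms(1) _ finite_set_in_borel[OF fin]]) auto
  moreover have "(B - F) \<union> (B \<inter> F) = B" by blast
  ultimately show ?thesis
    using finitely_additive_vm_finite_set[OF assms(1) fin] by simp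
qed

text \<open>Families with empty members and without full union are what arises in practice; they are
  turned into a partition by dropping the empty members and adding the remainder of \<open>A\<close>.\<close>

lemma sum_norm_le_variation:
  fixes \<mu> :: "'o::topological_space set \<Rightarrow> 'v::real_normed_vector"
  assumes "finite I" and C: "\<And>i. i \<in> I \<Longrightarrow> C i \<in> sets borel"
    and disj: "disjoint_family_on C I" and sub: "(\<Union>i\<in>I. C i) \<subseteq> A"
    and A: "A \<in> sets borel" and "\<mu> {} = 0"
  shows "(\<Sum>i\<in>I. ennreal (norm (\<mu> (C i)))) \<le> variation \<mu> A"
proof -
  define R where "R = A - (\<Union>i\<in>I. C i)"
  define P where "P = insert R (C ` I) - {{}}"
  let ?f = "\<lambda>B. ennreal (norm (\<mu> B))"
  have "(\<Sum>i\<in>I. ?f (C i)) = (\<Sum>B\<in>C ` I. ?f B)"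
  proof (subst sum.reindex_nontrivial[OF assms(1)])
    fix i j assume "i \<in> I" "j \<in> I" "i \<noteq> j" "C i = C j"
    then have "C i = {}" using disj unfolding disjoint_family_on_def by fastforce
    then show "?f (C i) = 0" using assms(6) by simp
  qed (simp add: o_def)
  also have "\<dots> = (\<Sum>B\<in>C ` I - {{}}. ?f B)"
    using assms(1,6) by (intro sum.mono_neutral_right) auto
  also have "\<dots> \<le> (\<Sum>B\<in>P. ?f B)"
    unfolding P_def using assms(1) by (intro sum_mono2) auto
  also have "\<dots> \<le> variation \<mu> A"
    unfolding variation_def
  proof (rule SUP_upper, rule CollectI)
    have "R \<in> sets borel" unfolding R_def using A C assms(1) by auto
    moreover have "partition_on A P"
      unfolding partition_on_def
    proof (intro conjI)
      have "\<Union>P = R \<union> (\<Union>i\<in>I. C i)" unfolding P_def by auto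
      then show "\<Union>P = A" using sub unfolding R_def by auto
      show "disjoint P"
      proof (rule disjointI)
        fix B D assume BD: "B \<in> P" "D \<in> P" "B \<noteq> D"
        have "R \<inter> C i = {}" if "i \<in> I" for i using that unfolding R_def by blast
        moreover have "C i \<inter> C j = {}" if "i \<in> I" "j \<in> I" "C i \<noteq> C j" for i j
          using disjoint_family_onD[OF disj that(1,2)] that(3) by blast
        ultimately show "B \<inter> D = {}"
          using BD unfolding P_def by (elim DiffE insertE imageE) (simp_all add: Int_commute)
      qed
    qed (simp add: P_def)
    ultimately show "borel_partition A P"
      unfolding borel_partition_def P_def using assms(1) C by auto
  qed
  finally show ?thesis .
qed

lemma variation_empty: "variation \<mu> {} = 0"
proof -
  have "variation \<mu> {} \<le> 0"
    unfolding variation_def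
  proof (rule SUP_least, drule CollectD)
    fix P :: "'a set set"
    assume "borel_partition {} P"
    then have "\<Union>P = {}" "{} \<notin> P" unfolding borel_partition_def partition_on_def by simp_all
    then have "P = {}" by (metis Union_empty_conv equals0I)
    then show "(\<Sum>B\<in>P. ennreal (norm (\<mu> B))) \<le> 0" by simp
  qed
  then show ?thesis by simp
qed

lemma variation_mono:
  fixes \<mu> :: "'o::topological_space set \<Rightarrow> 'v::real_normed_vector"
  assumes "A \<subseteq> B" and "B \<in> sets borel" and "\<mu> {} = 0"
  shows "variation \<mu> A \<le> variation \<mu> B"
  unfolding variation_def[of \<mu> A]
proof (rule SUP_least, drule CollectD)
  fix P assume P: "borel_partition A P"
  show "(\<Sum>C\<in>P. ennreal (norm (\<mu> C))) \<le> variation \<mu> B"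
  proof (rule sum_norm_le_variation[of P "\<lambda>C. C"])
    show "finite P" "\<And>C. C \<in> P \<Longrightarrow> C \<in> sets borel" "(\<Union>C\<in>P. C) \<subseteq> B"
      using P assms(1) unfolding borel_partition_def partition_on_def by auto
    show "disjoint_family_on (\<lambda>C. C) P"
      using P unfolding borel_partition_def partition_on_def disjoint_family_on_def disjoint_def
      by simp
  qed (use assms in simp_all)
qed

lemma variation_subadditive:
  fixes \<mu> :: "'o::topological_space set \<Rightarrow> 'v::real_normed_vector"
  assumes fa: "finitely_additive_vm \<mu>" and A: "A \<in> sets borel" and B: "B \<in> sets borel"
  shows "variation \<mu> (A \<union> B) \<le> variation \<mu> A + variation \<mu> B"
  unfolding variation_def[of \<mu> "A \<union> B"]
proof (rule SUP_least, drule CollectD)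
  fix P assume "borel_partition (A \<union> B) P"
  then have P: "finite P" "P \<subseteq> sets borel" "\<Union>P = A \<union> B" "disjoint P"
    unfolding borel_partition_def partition_on_def by auto
  note \<mu>0 = finitely_additive_vm_empty[OF fa]
  have disj_sub: "disjoint_family_on h P" if "\<And>C. h C \<subseteq> C" for h :: "'o set \<Rightarrow> 'o set"
    using disjointD[OF P(4)] that unfolding disjoint_family_on_def by blast
  have "(\<Sum>C\<in>P. ennreal (norm (\<mu> C)))
      \<le> (\<Sum>C\<in>P. ennreal (norm (\<mu> (C \<inter> A))) + ennreal (norm (\<mu> (C - A))))"
  proof (rule sum_mono)
    fix C assume "C \<in> P"
    then have "C \<in> sets borel" using P(2) by blast
    then have "\<mu> ((C \<inter> A) \<union> (C - A)) = \<mu> (C \<inter> A) + \<mu> (C - A)"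
      using A by (intro finitely_additive_vm_Un[OF fa]) auto
    moreover have "(C \<inter> A) \<union> (C - A) = C" by blast
    ultimately have "norm (\<mu> C) \<le> norm (\<mu> (C \<inter> A)) + norm (\<mu> (C - A))"
      by (simp add: norm_triangle_ineq)
    then show "ennreal (norm (\<mu> C)) \<le> ennreal (norm (\<mu> (C \<inter> A))) + ennreal (norm (\<mu> (C - A)))"
      by (simp flip: ennreal_plus add: ennreal_leI)
  qed
  also have "\<dots> = (\<Sum>C\<in>P. ennreal (norm (\<mu> (C \<inter> A)))) + (\<Sum>C\<in>P. ennreal (norm (\<mu> (C - A))))"
    by (rule sum.distrib)
  also have "\<dots> \<le> variation \<mu> A + variation \<mu> B"
  proof (rule add_mono)
    show "(\<Sum>C\<in>P. ennreal (norm (\<mu> (C \<inter> A)))) \<le> variation \<mu> A"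
    proof (rule sum_norm_le_variation[of P "\<lambda>C. C \<inter> A"])
      show "disjoint_family_on (\<lambda>C. C \<inter> A) P" by (rule disj_sub) blast
    qed (use P(1,2) A \<mu>0 in auto)
    show "(\<Sum>C\<in>P. ennreal (norm (\<mu> (C - A)))) \<le> variation \<mu> B"
    proof (rule sum_norm_le_variation[of P "\<lambda>C. C - A"])
      show "disjoint_family_on (\<lambda>C. C - A) P" by (rule disj_sub) blast
      show "(\<Union>C\<in>P. C - A) \<subseteq> B" using P(3) by blast
    qed (use P(1,2) A B \<mu>0 in auto)
  qed
  finally show "(\<Sum>C\<in>P. ennreal (norm (\<mu> C))) \<le> variation \<mu> A + variation \<mu> B" .
qed

lemma blinfun_almost_attains_norm:
  fixes \<phi> :: "'a::real_normed_vector \<Rightarrow>\<^sub>L real"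
  assumes "0 < d"
  shows "\<exists>x. norm x \<le> 1 \<and> norm \<phi> - d \<le> blinfun_apply \<phi> x"
proof (rule ccontr)
  assume "\<not> ?thesis"
  then have less: "blinfun_apply \<phi> x < norm \<phi> - d" if "norm x \<le> 1" for x
    using that by force
  have "norm \<phi> \<le> norm \<phi> - d"
  proof (rule norm_blinfun_bound)
    show "0 \<le> norm \<phi> - d" using less[of 0] by simp
    fix x :: 'a
    show "norm (blinfun_apply \<phi> x) \<le> (norm \<phi> - d) * norm x"
    proof (cases "x = 0")
      case False
      have "blinfun_apply \<phi> ((sgn (blinfun_apply \<phi> x) / norm x) *\<^sub>R x) < norm \<phi> - d"
        using False by (intro less) (simp add: sgn_real_def)
      then have "\<bar>blinfun_apply \<phi> x\<bar> / norm x < norm \<phi> - d"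
        by (simp add: blinfun.scaleR_right abs_sgn mult.commute)
      then show ?thesis using False by (simp add: field_simps)
    qed simp
  qed
  then show False using assms by simp
qed

text \<open>In each set \<open>B\<close> of a partition choose a vector of the unit ball that almost norms the functional
  \<open>z o\<^sub>L m B\<close>.  The sum of the norms is then almost the value of \<open>z\<close> at one of the vectors over which
  the semivariation is the supremum.\<close>

lemma variation_le_semivariation:
  fixes m :: "'o::topological_space set \<Rightarrow> 'x::real_normed_vector \<Rightarrow>\<^sub>L 'z::real_normed_vector"
    and z :: "'z \<Rightarrow>\<^sub>L real"
  assumes "norm z \<le> K"
  shows "variation (\<lambda>B. z o\<^sub>L m B) A \<le> ennreal K * semivariation m A"
  unfolding variation_def
proof (rule SUP_least, drule CollectD)
  fix P assume P: "borel_partition A P"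
  have K: "0 \<le> K" using assms norm_ge_zero[of z] by linarith
  show "(\<Sum>B\<in>P. ennreal (norm (z o\<^sub>L m B))) \<le> ennreal K * semivariation m A"
  proof (rule ennreal_le_epsilon)
    fix e :: real assume e: "0 < e"
    define d where "d = e / (real (card P) + 1)"
    have d: "0 < d" unfolding d_def using e by simp
    obtain x where x: "\<And>B. norm (x B) \<le> 1"
        "\<And>B. norm (z o\<^sub>L m B) - d \<le> blinfun_apply (z o\<^sub>L m B) (x B)"
      using blinfun_almost_attains_norm[OF d, of "z o\<^sub>L m _"] by metis
    let ?S = "\<Sum>B\<in>P. blinfun_apply (m B) (x B)"
    have "(\<Sum>B\<in>P. norm (z o\<^sub>L m B)) \<le> (\<Sum>B\<in>P. blinfun_apply (z o\<^sub>L m B) (x B) + d)"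
      by (intro sum_mono) (metis x(2) diff_le_eq)
    also have "\<dots> = blinfun_apply z ?S + real (card P) * d"
      by (simp add: sum.distrib blinfun.sum_right)
    also have "\<dots> \<le> K * norm ?S + e"
    proof (rule add_mono)
      have "blinfun_apply z ?S \<le> norm z * norm ?S" using norm_blinfun[of z ?S] by simp
      also have "\<dots> \<le> K * norm ?S" using assms by (simp add: mult_right_mono)
      finally show "blinfun_apply z ?S \<le> K * norm ?S" .
      show "real (card P) * d \<le> e" unfolding d_def using e by (simp add: field_simps)
    qed
    finally have "(\<Sum>B\<in>P. ennreal (norm (z o\<^sub>L m B))) \<le> ennreal (K * norm ?S + e)"
      by (simp add: sum_ennreal ennreal_leI)
    also have "\<dots> = ennreal K * ennreal (norm ?S) + ennreal e"
      using K e by (simp add: ennreal_mult)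
    also have "\<dots> \<le> ennreal K * semivariation m A + ennreal e"
    proof (intro add_right_mono mult_left_mono)
      show "ennreal (norm ?S) \<le> semivariation m A"
        unfolding semivariation_def
        using P x(1) by (intro SUP_upper2[where i = "(P, x)"]) auto
    qed simp
    finally show "(\<Sum>B\<in>P. ennreal (norm (z o\<^sub>L m B))) \<le> ennreal K * semivariation m A + ennreal e" .
  qed
qed


section \<open>Concentration on finite sets\<close>

text \<open>Call an open set good if removing a suitable finite set leaves arbitrarily small variation.
  Good sets are closed under finite unions, so by inner regularity an open set covered by good sets
  up to one point is good.  If the good sets did not cover the space, their union would
  have a nonempty closed complement, and an isolated point of it would have a neighbourhood of
  exactly this kind.  Hence the good sets cover the space, and compactness finishes the proof.\<close>

lemma dispersed_regular_vm_concentrated: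
  fixes \<mu> :: "'o::t2_space set \<Rightarrow> 'v::real_normed_vector"
  assumes comp: "compact (UNIV :: 'o set)" and disp: "dispersed TYPE('o)"
    and fa: "finitely_additive_vm \<mu>" and reg: "regular_vm \<mu>" and "0 < e"
  shows "\<exists>G. finite G \<and> variation \<mu> (- G) < ennreal e"
proof -
  note \<mu>0 = finitely_additive_vm_empty[OF fa]
  define good where "good U \<longleftrightarrow> open U \<and>
    (\<forall>e>0. \<exists>G. finite G \<and> variation \<mu> (U - G) < ennreal e)" for U :: "'o set"
  have small_union: "variation \<mu> C < ennreal e"
    if "C \<subseteq> A \<union> B" "A \<in> sets borel" "B \<in> sets borel"
      "variation \<mu> A < ennreal (e/2)" "variation \<mu> B < ennreal (e/2)" "0 < e"
    for A B C :: "'o set" and e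
  proof -
    have "variation \<mu> C \<le> variation \<mu> (A \<union> B)"
      using that by (intro variation_mono \<mu>0) auto
    also have "\<dots> \<le> variation \<mu> A + variation \<mu> B"
      using that by (intro variation_subadditive fa)
    also have "\<dots> < ennreal (e/2) + ennreal (e/2)"
      using that by (intro add_strict_mono)
    also have "\<dots> = ennreal e" using that(6) by (simp flip: ennreal_plus)
    finally show ?thesis .
  qed
  have borel_diff: "U - G \<in> sets borel" if "open U" "finite G" for U G :: "'o set"
    using that by (intro sets.Diff finite_set_in_borel borel_open)
  have good_open: "open U" if "good U" for U
    using that unfolding good_def by simp
  have goodE: "\<exists>G. finite G \<and> variation \<mu> (U - G) < ennreal e" if "good U" "0 < e" for U e
    using that unfolding good_def by simp
  have good_Un: "good (U \<union> V)" if gUV: "good U" "good V" for U V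
    unfolding good_def
  proof (intro conjI allI impI)
    show "open (U \<union> V)" using gUV good_open by blast
    fix e :: real assume "0 < e"
    then have "0 < e/2" by simp
    obtain G where G: "finite G" "variation \<mu> (U - G) < ennreal (e/2)"
      using goodE[OF gUV(1) \<open>0 < e/2\<close>] by blast
    obtain H where H: "finite H" "variation \<mu> (V - H) < ennreal (e/2)"
      using goodE[OF gUV(2) \<open>0 < e/2\<close>] by blast
    have "variation \<mu> (U \<union> V - (G \<union> H)) < ennreal e"
    proof (rule small_union[OF _ _ _ G(2) H(2) \<open>0 < e\<close>])
      show "U - G \<in> sets borel" "V - H \<in> sets borel"
        using gUV G(1) H(1) by (simp_all add: borel_diff good_open)
    qed auto
    then show "\<exists>G. finite G \<and> variation \<mu> (U \<union> V - G) < ennreal e"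
      using G(1) H(1) by blast
  qed
  have good_empty: "good {}"
    unfolding good_def by (auto simp: variation_empty)
  have good_finite_Union: "good (\<Union>\<U>)" if "finite \<U>" "\<forall>U\<in>\<U>. good U" for \<U>
    using that by (induction \<U> rule: finite_induct) (auto intro: good_Un good_empty)
  define V where "V = \<Union>{U. good U}"
  have "open V" unfolding V_def using good_open by blast
  have compact_good: "\<exists>U. good U \<and> L \<subseteq> U" if L: "compact L" "L \<subseteq> V" for L
  proof -
    obtain \<U> where "\<U> \<subseteq> {U. good U}" "finite \<U>" "L \<subseteq> \<Union>\<U>"
      using compactE[OF L(1), of "{U. good U}"] L(2) good_open unfolding V_def
      by (metis mem_Collect_eq)
    then show ?thesis using good_finite_Union[of \<U>] by blast
  qed
  have "V = UNIV"
  proof (rule ccontr)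
    assume "V \<noteq> UNIV"
    then have "closed (- V)" "- V \<noteq> {}" using \<open>open V\<close> by auto
    then obtain \<omega> where "\<omega> isolated_in (- V)"
      using disp unfolding dispersed_def by blast
    then obtain W where W: "open W" "W \<inter> - V = {\<omega>}" and "\<omega> \<in> - V"
      unfolding isolated_in_def by blast
    have "good W"
      unfolding good_def
    proof (intro conjI allI impI)
      fix e :: real assume "0 < e"
      then have e2: "0 < e/2" by simp
      have W\<omega>: "W - {\<omega>} \<in> sets borel" using W(1) by (simp add: borel_diff)
      \<comment> \<open>The compact part \<open>L\<close> of \<open>W - {\<omega>}\<close> lies in \<open>V\<close>, hence in a single good set.\<close>
      obtain L O' where L: "compact L" "L \<subseteq> W - {\<omega>}" and O': "open O'" "W - {\<omega>} \<subseteq> O'"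
          "variation \<mu> (O' - L) < ennreal (e/2)"
        using reg W\<omega> e2 unfolding regular_vm_def by meson
      have L_borel: "L \<in> sets borel" using L(1) by (simp add: borel_closed compact_imp_closed)
      have O'_borel: "O' - L \<in> sets borel" using borel_open[OF O'(1)] L_borel by (rule sets.Diff)
      obtain U where U: "good U" "L \<subseteq> U" 
      proof -
        have "L \<subseteq> V" using L(2) W(2) by blast
        then show thesis using compact_good[OF L(1)] that by blast
      qed
      obtain G where G: "finite G" "variation \<mu> (U - G) < ennreal (e/2)"
        using goodE[OF U(1) e2] by blast
      have "variation \<mu> (W - insert \<omega> G) < ennreal e"
      proof (rule small_union[OF _ _ O'_borel G(2) O'(3) \<open>0 < e\<close>])
        show "U - G \<in> sets borel" using U(1) G(1) by (simp add: borel_diff good_open)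
        show "W - insert \<omega> G \<subseteq> (U - G) \<union> (O' - L)" using U(2) O'(2) by blast
      qed
      then show "\<exists>G. finite G \<and> variation \<mu> (W - G) < ennreal e"
        using G(1) by (intro exI[of _ "insert \<omega> G"]) simp
    qed (rule W(1))
    then have "\<omega> \<in> V" using W(2) unfolding V_def by blast
    then show False using \<open>\<omega> \<in> - V\<close> by simp
  qed
  then obtain U where "good U" "UNIV \<subseteq> U" using compact_good[OF comp] by blast
  then have "good UNIV" by (simp add: top.extremum_unique)
  then show ?thesis using goodE[OF _ \<open>0 < e\<close>] by (simp add: Compl_eq_Diff_UNIV)
qed

text \<open>If no finite set worked, then for every finite \<open>F\<close> some functional in the ball would have
  variation more than \<open>e\<close> off \<open>F\<close>, and by concentration more than \<open>e/2\<close> on a finite set disjoint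
  from \<open>F\<close>.  Iterating gives disjoint finite sets whose semivariations stay away from \<open>0\<close>, against
  strong boundedness.\<close>

lemma strongly_bounded_uniformly_concentrated:
  fixes m :: "'o::t2_space set \<Rightarrow> 'x::real_normed_vector \<Rightarrow>\<^sub>L 'z::real_normed_vector"
  assumes comp: "compact (UNIV :: 'o set)" and disp: "dispersed TYPE('o)"
    and fa: "\<And>z :: 'z \<Rightarrow>\<^sub>L real. finitely_additive_vm (\<lambda>B. z o\<^sub>L m B)"
    and reg: "\<And>z :: 'z \<Rightarrow>\<^sub>L real. regular_vm (\<lambda>B. z o\<^sub>L m B)"
    and sb: "strongly_bounded m" and "0 < e"
  shows "\<exists>F. finite F \<and>
    (\<forall>z :: 'z \<Rightarrow>\<^sub>L real. norm z \<le> K \<longrightarrow> variation (\<lambda>B. z o\<^sub>L m B) (- F) \<le> ennreal e)"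
proof (rule ccontr)
  assume no_F: "\<not> ?thesis"
  have e2: "0 < e/2" using \<open>0 < e\<close> by simp
  have step: "\<exists>G. finite G \<and> G \<inter> F = {} \<and> ennreal (e/2) \<le> ennreal K * semivariation m G"
    if F: "finite F" for F
  proof -
    obtain z :: "'z \<Rightarrow>\<^sub>L real" where z: "norm z \<le> K"
        "ennreal e < variation (\<lambda>B. z o\<^sub>L m B) (- F)"
      using no_F F by (meson not_le)
    let ?\<mu> = "\<lambda>B. z o\<^sub>L m B"
    obtain G where G: "finite G" "variation ?\<mu> (- G) < ennreal (e/2)"
      using dispersed_regular_vm_concentrated[OF comp disp fa reg e2] by blast
    have GF: "G - F \<in> sets borel" "- G \<in> sets borel"
      using G(1) finite_set_in_borel[of G] finite_set_in_borel[of "G - F"] by auto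
    have "ennreal (e/2) + ennreal (e/2) = ennreal e"
      using \<open>0 < e\<close> by (simp flip: ennreal_plus)
    also have "\<dots> < variation ?\<mu> (- F)" by (rule z(2))
    also have "\<dots> \<le> variation ?\<mu> ((G - F) \<union> - G)"
      using GF by (intro variation_mono finitely_additive_vm_empty fa) auto
    also have "\<dots> \<le> variation ?\<mu> (G - F) + variation ?\<mu> (- G)"
      using GF by (intro variation_subadditive fa)
    also have "\<dots> \<le> variation ?\<mu> (G - F) + ennreal (e/2)"
      using G(2) by (intro add_left_mono) simp
    finally have "ennreal (e/2) \<le> variation ?\<mu> (G - F)"
      by (metis add.commute ennreal_add_left_cancel_less ennreal_neq_top less_imp_le)
    also have "\<dots> \<le> ennreal K * semivariation m (G - F)"
      by (rule variation_le_semivariation[OF z(1)])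
    finally show ?thesis using G(1) by (intro exI[of _ "G - F"]) auto
  qed
  then obtain g where g: "\<And>F. finite F \<Longrightarrow> finite (g F) \<and> g F \<inter> F = {} \<and>
      ennreal (e/2) \<le> ennreal K * semivariation m (g F)" by metis
  \<comment> \<open>\<open>H n\<close> is the union of the first \<open>n\<close> sets chosen, and \<open>g (H n)\<close> is the next one.\<close>
  define H where "H n = ((\<lambda>F. F \<union> g F) ^^ n) {}" for n :: nat
  have H_Suc: "H (Suc n) = H n \<union> g (H n)" for n unfolding H_def by simp
  have H_fin: "finite (H n)" for n
    by (induction n) (use g in \<open>auto simp: H_Suc\<close>, simp add: H_def)
  have "mono H" by (auto simp: mono_iff_le_Suc H_Suc)
  have disj: "g (H i) \<inter> g (H j) = {}" if "i < j" for i j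
  proof -
    have "g (H i) \<subseteq> H (Suc i)" by (simp add: H_Suc)
    also have "\<dots> \<subseteq> H j" by (rule monoD[OF \<open>mono H\<close>]) (use that in simp)
    finally show ?thesis using g[OF H_fin[of j]] by blast
  qed
  have "disjoint_family (\<lambda>n. g (H n))"
    unfolding disjoint_family_on_def using disj by (metis inf_commute linorder_neqE_nat)
  moreover have "range (\<lambda>n. g (H n)) \<subseteq> sets borel"
    using g[OF H_fin] finite_set_in_borel by auto
  ultimately have "(\<lambda>n. semivariation m (g (H n))) \<longlonglongrightarrow> 0"
    using sb unfolding strongly_bounded_def by simp
  then have "(\<lambda>n. ennreal K * semivariation m (g (H n))) \<longlonglongrightarrow> ennreal K * 0"
    by (rule ennreal_tendsto_cmult[rotated]) simp
  then have "ennreal (e/2) \<le> ennreal K * 0"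
    by (rule LIMSEQ_le_const) (use g[OF H_fin] in blast)
  then show False using e2 by simp
qed


section \<open>Integrals against a concentrated measure\<close>

text \<open>Cut each level set of \<open>s\<close> along \<open>F\<close>.  The parts inside \<open>F\<close> give the finite sum exactly; the
  parts outside are disjoint subsets of \<open>- F\<close>, and so contribute at most \<open>c\<close> times the variation there.\<close>

lemma simple_integral_near_finite_sum:
  fixes m :: "'o::t2_space set \<Rightarrow> 'x::real_normed_vector \<Rightarrow>\<^sub>L 'z::real_normed_vector"
    and z :: "'z \<Rightarrow>\<^sub>L real"
  assumes fa: "finitely_additive_vm (\<lambda>B. z o\<^sub>L m B)" and F: "finite F"
    and var: "variation (\<lambda>B. z o\<^sub>L m B) (- F) \<le> ennreal e" and e: "0 \<le> e"
    and s: "simple_function borel s" and c: "\<And>\<omega>. norm (s \<omega>) \<le> c"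
  shows "\<bar>blinfun_apply z (vm_simple_integral m s)
      - (\<Sum>\<omega>\<in>F. blinfun_apply z (blinfun_apply (m {\<omega>}) (s \<omega>)))\<bar> \<le> c * e"
proof -
  let ?\<mu> = "\<lambda>B. z o\<^sub>L m B"
  have fin: "finite (range s)" using simple_functionD(1)[OF s] by simp
  have meas: "s -` {x} \<in> sets borel" for x using simple_functionD(2)[OF s, of "{x}"] by simp
  have F_borel: "F \<in> sets borel" by (rule finite_set_in_borel[OF F])
  have diff: "s -` {x} - F \<in> sets borel" for x using meas F_borel by (rule sets.Diff)
  have c0: "0 \<le> c" using c[of undefined] norm_ge_zero order_trans by blast
  have split: "blinfun_apply (?\<mu> (s -` {x})) x = blinfun_apply (?\<mu> (s -` {x} - F)) x
      + (\<Sum>\<omega>\<in>{\<omega>. \<omega> \<in> F \<and> s \<omega> = x}. blinfun_apply (?\<mu> {\<omega>}) (s \<omega>))" for x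
  proof -
    have "s -` {x} \<inter> F = {\<omega>. \<omega> \<in> F \<and> s \<omega> = x}" by auto
    then have "?\<mu> (s -` {x}) = ?\<mu> (s -` {x} - F) + (\<Sum>\<omega>\<in>{\<omega>. \<omega> \<in> F \<and> s \<omega> = x}. ?\<mu> {\<omega>})"
      using finitely_additive_vm_split_finite[OF fa F meas[of x]] by simp
    then have "blinfun_apply (?\<mu> (s -` {x})) x = blinfun_apply (?\<mu> (s -` {x} - F)) x
        + (\<Sum>\<omega>\<in>{\<omega>. \<omega> \<in> F \<and> s \<omega> = x}. blinfun_apply (?\<mu> {\<omega>}) x)"
      by (simp only: plus_blinfun.rep_eq blinfun.sum_left)
    then show ?thesis by simp
  qed
  have "blinfun_apply z (vm_simple_integral m s)
      = (\<Sum>x\<in>range s. blinfun_apply (?\<mu> (s -` {x})) x)"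
    unfolding vm_simple_integral_def by (simp add: blinfun.sum_right)
  also have "\<dots> = (\<Sum>x\<in>range s. blinfun_apply (?\<mu> (s -` {x} - F)) x)
      + (\<Sum>x\<in>range s. \<Sum>\<omega>\<in>{\<omega>. \<omega> \<in> F \<and> s \<omega> = x}. blinfun_apply (?\<mu> {\<omega>}) (s \<omega>))"
    by (simp only: split sum.distrib)
  also have "(\<Sum>x\<in>range s. \<Sum>\<omega>\<in>{\<omega>. \<omega> \<in> F \<and> s \<omega> = x}. blinfun_apply (?\<mu> {\<omega>}) (s \<omega>))
      = (\<Sum>\<omega>\<in>F. blinfun_apply (?\<mu> {\<omega>}) (s \<omega>))"
    by (rule sum.group[OF F fin]) auto
  finally have "\<bar>blinfun_apply z (vm_simple_integral m s)
      - (\<Sum>\<omega>\<in>F. blinfun_apply (?\<mu> {\<omega>}) (s \<omega>))\<bar>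
      = \<bar>\<Sum>x\<in>range s. blinfun_apply (?\<mu> (s -` {x} - F)) x\<bar>" by simp
  also have "\<dots> \<le> (\<Sum>x\<in>range s. \<bar>blinfun_apply (?\<mu> (s -` {x} - F)) x\<bar>)"
    by (rule sum_abs)
  also have "\<dots> \<le> (\<Sum>x\<in>range s. norm (?\<mu> (s -` {x} - F)) * c)"
  proof (rule sum_mono)
    fix x assume "x \<in> range s"
    then have "norm x \<le> c" using c by blast
    then have "norm (?\<mu> (s -` {x} - F)) * norm x \<le> norm (?\<mu> (s -` {x} - F)) * c"
      by (rule mult_left_mono) simp
    then show "\<bar>blinfun_apply (?\<mu> (s -` {x} - F)) x\<bar> \<le> norm (?\<mu> (s -` {x} - F)) * c"
      using norm_blinfun[of "?\<mu> (s -` {x} - F)" x] by (simp only: real_norm_def)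
  qed
  also have "\<dots> = (\<Sum>x\<in>range s. norm (?\<mu> (s -` {x} - F))) * c"
    by (rule sum_distrib_right[symmetric])
  also have "\<dots> \<le> e * c"
  proof (rule mult_right_mono[OF _ c0])
    have "(\<Sum>x\<in>range s. ennreal (norm (?\<mu> (s -` {x} - F)))) \<le> variation ?\<mu> (- F)"
      using diff fin F_borel finitely_additive_vm_empty[OF fa]
      by (intro sum_norm_le_variation) (auto simp: disjoint_family_on_def)
    also have "\<dots> \<le> ennreal e" by (rule var)
    finally show "(\<Sum>x\<in>range s. norm (?\<mu> (s -` {x} - F))) \<le> e"
      using e by (simp add: sum_ennreal ennreal_le_iff)
  qed
  finally show ?thesis by (simp add: mult.commute)
qed

lemma integral_near_finite_sum:
  fixes m :: "'o::t2_space set \<Rightarrow> 'x::real_normed_vector \<Rightarrow>\<^sub>L 'z::real_normed_vector"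
    and z :: "'z \<Rightarrow>\<^sub>L real"
  assumes fa: "finitely_additive_vm (\<lambda>B. z o\<^sub>L m B)" and F: "finite F"
    and var: "variation (\<lambda>B. z o\<^sub>L m B) (- F) \<le> ennreal e" and e: "0 \<le> e"
    and int: "vm_has_integral m f I" and c: "\<And>\<omega>. norm (f \<omega>) \<le> c"
  shows "\<bar>blinfun_apply z I
      - (\<Sum>\<omega>\<in>F. blinfun_apply z (blinfun_apply (m {\<omega>}) (f \<omega>)))\<bar> \<le> c * e"
proof -
  obtain s where s: "\<And>n. simple_function borel (s n)" "uniform_limit UNIV s f sequentially"
      "(\<lambda>n. vm_simple_integral m (s n)) \<longlonglongrightarrow> I"
    using int unfolding vm_has_integral_def by blast
  have ptw: "(\<lambda>n. s n \<omega>) \<longlonglongrightarrow> f \<omega>" for \<omega>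
    using tendsto_uniform_limitI[OF s(2)] by simp
  have lim: "(\<lambda>n. \<bar>blinfun_apply z (vm_simple_integral m (s n))
        - (\<Sum>\<omega>\<in>F. blinfun_apply z (blinfun_apply (m {\<omega>}) (s n \<omega>)))\<bar>)
      \<longlonglongrightarrow> \<bar>blinfun_apply z I
        - (\<Sum>\<omega>\<in>F. blinfun_apply z (blinfun_apply (m {\<omega>}) (f \<omega>)))\<bar>"
    by (intro tendsto_intros blinfun.tendsto s(3) ptw)
  have bound: "\<bar>blinfun_apply z I
      - (\<Sum>\<omega>\<in>F. blinfun_apply z (blinfun_apply (m {\<omega>}) (f \<omega>)))\<bar> \<le> (c + d) * e"
    if d: "0 < d" for d
  proof (rule tendsto_upperbound[OF lim])
    have "\<forall>\<^sub>F n in sequentially. \<forall>\<omega>\<in>UNIV. dist (s n \<omega>) (f \<omega>) < d"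
      using s(2) d by (rule uniform_limitD)
    then show "\<forall>\<^sub>F n in sequentially. \<bar>blinfun_apply z (vm_simple_integral m (s n))
        - (\<Sum>\<omega>\<in>F. blinfun_apply z (blinfun_apply (m {\<omega>}) (s n \<omega>)))\<bar> \<le> (c + d) * e"
    proof eventually_elim
      case (elim n)
      have "norm (s n \<omega>) \<le> c + d" for \<omega>
        using elim c[of \<omega>] norm_triangle_ineq2[of "s n \<omega>" "f \<omega>"]
        unfolding dist_norm by (smt (verit) UNIV_I)
      then show ?case by (rule simple_integral_near_finite_sum[OF fa F var e s(1)])
    qed
  qed simp
  \<comment> \<open>The approximating simple functions may exceed the bound \<open>c\<close>, by an amount \<open>d\<close> that tends to \<open>0\<close>.\<close>
  have "((\<lambda>d. (c + d) * e) \<longlongrightarrow> (c + 0) * e) (at_right 0)"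
    by (intro tendsto_intros)
  then have "\<bar>blinfun_apply z I
      - (\<Sum>\<omega>\<in>F. blinfun_apply z (blinfun_apply (m {\<omega>}) (f \<omega>)))\<bar> \<le> (c + 0) * e"
    by (rule tendsto_lowerbound) (auto simp: eventually_at_filter bound)
  then show ?thesis by simp
qed


section \<open>Comparison of the operator with its measure\<close>

text \<open>A compact Hausdorff space is normal, so Urysohn's lemma separates \<open>F - A\<close> from \<open>F \<inter> A\<close>.\<close>

lemma continuous_indicator_on_finite_set:
  fixes F :: "'o::t2_space set"
  assumes comp: "compact (UNIV :: 'o set)" and F: "finite F"
  obtains g :: "'o \<Rightarrow> real" where "continuous_on UNIV g" "\<And>\<omega>. 0 \<le> g \<omega> \<and> g \<omega> \<le> 1"
    "\<And>\<omega>. \<omega> \<in> F \<Longrightarrow> g \<omega> = indicator A \<omega>"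
proof -
  have "Hausdorff_space (euclidean :: 'o topology)"
    unfolding Hausdorff_space_def by (simp add: disjnt_def) (meson hausdorff)
  moreover have "compact_space (euclidean :: 'o topology)"
    using comp by (simp add: compact_space_def)
  ultimately have "normal_space (euclidean :: 'o topology)"
    by (simp add: compact_Hausdorff_or_regular_imp_normal_space)
  moreover have "closedin euclidean (F - A)" "closedin euclidean (F \<inter> A)"
    using F by (auto simp: finite_imp_closed)
  moreover have "disjnt (F - A) (F \<inter> A)" unfolding disjnt_def by blast
  ultimately obtain g where g: "continuous_map euclidean (top_of_set {0..1::real}) g"
      "g ` (F - A) \<subseteq> {0}" "g ` (F \<inter> A) \<subseteq> {1}"
    using Urysohn_lemma[of euclidean "F - A" "F \<inter> A" 0 1] by auto
  show thesis
  proof (rule that[of g])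
    show "continuous_on UNIV g" "\<And>\<omega>. 0 \<le> g \<omega> \<and> g \<omega> \<le> 1"
      using g(1) by (auto simp: continuous_map_in_subtopology)
    show "g \<omega> = indicator A \<omega>" if "\<omega> \<in> F" for \<omega>
      using g(2,3) that by (auto simp: indicator_def)
  qed
qed

text \<open>Both estimates replace integrals by sums over a finite set \<open>F\<close> off which all measures
  \<open>z o\<^sub>L m\<close> in the ball are small.  In the second, a continuous function that agrees with the
  indicator of \<open>A\<close> on \<open>F\<close> plays the role of that indicator.\<close>

lemma adjoint_measure_estimates:
  fixes T :: "('o::t2_space \<Rightarrow>\<^sub>C 'x::real_normed_vector) \<Rightarrow>\<^sub>L 'z::real_normed_vector"
    and m :: "'o set \<Rightarrow> 'x \<Rightarrow>\<^sub>L 'z"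
  assumes comp: "compact (UNIV :: 'o set)" and disp: "dispersed TYPE('o)"
    and rep: "representing_measure T (\<lambda>A. bidual_embedding o\<^sub>L m A)"
    and sb: "strongly_bounded m" and e: "0 < e"
  obtains F where "finite F"
    "\<And>z :: 'z \<Rightarrow>\<^sub>L real. norm z \<le> K \<Longrightarrow>
      norm (z o\<^sub>L T) \<le> (\<Sum>\<omega>\<in>F. norm (z o\<^sub>L m {\<omega>})) + e"
    "\<And>(z :: 'z \<Rightarrow>\<^sub>L real) A. norm z \<le> K \<Longrightarrow> A \<in> sets borel \<Longrightarrow>
      norm (z o\<^sub>L m A) \<le> norm (z o\<^sub>L T) + 2 * e"
proof -
  let ?m = "\<lambda>A. bidual_embedding o\<^sub>L m A"
  have \<mu>: "blinfun_apply bidual_embedding z o\<^sub>L ?m A = z o\<^sub>L m A" for z :: "'z \<Rightarrow>\<^sub>L real" and A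
    by (rule blinfun_eqI) simp
  have fa: "finitely_additive_vm (\<lambda>A. z o\<^sub>L m A)" for z :: "'z \<Rightarrow>\<^sub>L real"
    using finitely_additive_vm_blinfun_compose[of ?m "blinfun_apply bidual_embedding z"] rep
    unfolding representing_measure_def by (simp only: \<mu>)
  have reg: "regular_vm (\<lambda>A. z o\<^sub>L m A)" for z :: "'z \<Rightarrow>\<^sub>L real"
    using rep unfolding representing_measure_def rcabv_def by (simp only: \<mu>)
  obtain F where F: "finite F" and var:
      "\<And>z :: 'z \<Rightarrow>\<^sub>L real. norm z \<le> K \<Longrightarrow> variation (\<lambda>B. z o\<^sub>L m B) (- F) \<le> ennreal e"
    using strongly_bounded_uniformly_concentrated[OF comp disp fa reg sb e] by metis
  have near: "\<bar>blinfun_apply z (blinfun_apply T f)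
      - (\<Sum>\<omega>\<in>F. blinfun_apply (z o\<^sub>L m {\<omega>}) (apply_bcontfun f \<omega>))\<bar> \<le> c * e"
    if z: "norm z \<le> K" and c: "\<And>\<omega>. norm (apply_bcontfun f \<omega>) \<le> c"
    for z :: "'z \<Rightarrow>\<^sub>L real" and f c
  proof -
    have "vm_has_integral ?m (apply_bcontfun f)
        (blinfun_apply bidual_embedding (blinfun_apply T f))"
      using rep unfolding representing_measure_def by blast
    from integral_near_finite_sum[of "blinfun_apply bidual_embedding z" ?m, OF _ F _ _ this c,
        unfolded \<mu>, OF fa var[OF z]]
    show ?thesis using e by simp
  qed
  show thesis
  proof (rule that[OF F])
    fix z :: "'z \<Rightarrow>\<^sub>L real" assume z: "norm z \<le> K"
    show "norm (z o\<^sub>L T) \<le> (\<Sum>\<omega>\<in>F. norm (z o\<^sub>L m {\<omega>})) + e"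
    proof (rule norm_blinfun_bound)
      show "0 \<le> (\<Sum>\<omega>\<in>F. norm (z o\<^sub>L m {\<omega>})) + e"
        using e by (simp add: sum_nonneg add_nonneg_nonneg)
      fix f :: "'o \<Rightarrow>\<^sub>C 'x"
      have "\<bar>\<Sum>\<omega>\<in>F. blinfun_apply (z o\<^sub>L m {\<omega>}) (apply_bcontfun f \<omega>)\<bar>
          \<le> (\<Sum>\<omega>\<in>F. \<bar>blinfun_apply (z o\<^sub>L m {\<omega>}) (apply_bcontfun f \<omega>)\<bar>)"
        by (rule sum_abs)
      also have "\<dots> \<le> (\<Sum>\<omega>\<in>F. norm (z o\<^sub>L m {\<omega>}) * norm f)"
      proof (rule sum_mono)
        fix \<omega>
        have "\<bar>blinfun_apply (z o\<^sub>L m {\<omega>}) (apply_bcontfun f \<omega>)\<bar>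
            \<le> norm (z o\<^sub>L m {\<omega>}) * norm (apply_bcontfun f \<omega>)"
          using norm_blinfun[of "z o\<^sub>L m {\<omega>}" "apply_bcontfun f \<omega>"] by (simp only: real_norm_def)
        also have "\<dots> \<le> norm (z o\<^sub>L m {\<omega>}) * norm f"
          by (intro mult_left_mono norm_bounded norm_ge_zero)
        finally show "\<bar>blinfun_apply (z o\<^sub>L m {\<omega>}) (apply_bcontfun f \<omega>)\<bar>
            \<le> norm (z o\<^sub>L m {\<omega>}) * norm f" .
      qed
      also have "\<dots> = (\<Sum>\<omega>\<in>F. norm (z o\<^sub>L m {\<omega>})) * norm f"
        by (rule sum_distrib_right[symmetric])
      finally show "norm (blinfun_apply (z o\<^sub>L T) f)
          \<le> ((\<Sum>\<omega>\<in>F. norm (z o\<^sub>L m {\<omega>})) + e) * norm f"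
        using near[OF z norm_bounded, of f] by (simp add: algebra_simps)
    qed
  next
    fix z :: "'z \<Rightarrow>\<^sub>L real" and A :: "'o set"
    assume z: "norm z \<le> K" and A: "A \<in> sets borel"
    obtain g :: "'o \<Rightarrow> real" where g: "continuous_on UNIV g" "\<And>\<omega>. 0 \<le> g \<omega> \<and> g \<omega> \<le> 1"
        "\<And>\<omega>. \<omega> \<in> F \<Longrightarrow> g \<omega> = indicator A \<omega>"
      using continuous_indicator_on_finite_set[OF comp F] by blast
    have off_F: "norm (z o\<^sub>L m (A - F)) \<le> e"
    proof -
      have "A - F \<in> sets borel" "- F \<in> sets borel"
        using A finite_set_in_borel[OF F] by auto
      \<comment> \<open>A family with the single member \<open>A - F\<close>.\<close>
      then have "(\<Sum>i\<in>{()}. ennreal (norm (z o\<^sub>L m (A - F)))) \<le> variation (\<lambda>B. z o\<^sub>L m B) (- F)"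
        using finitely_additive_vm_empty[OF fa]
        by (intro sum_norm_le_variation) (auto simp: disjoint_family_on_def)
      also have "\<dots> \<le> ennreal e" by (rule var[OF z])
      finally show ?thesis using e by (simp add: ennreal_le_iff)
    qed
    show "norm (z o\<^sub>L m A) \<le> norm (z o\<^sub>L T) + 2 * e"
    proof (rule norm_blinfun_bound)
      show "0 \<le> norm (z o\<^sub>L T) + 2 * e" using e by (simp add: add_nonneg_nonneg)
      fix x :: 'x
      define f where "f = Bcontfun (\<lambda>\<omega>. g \<omega> *\<^sub>R x)"
      have gx: "norm (g \<omega> *\<^sub>R x) \<le> norm x" for \<omega>
        using g(2)[of \<omega>] by (simp add: mult_left_le_one_le)
      have f: "apply_bcontfun f \<omega> = g \<omega> *\<^sub>R x" for \<omega>
        unfolding f_def using gx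
        by (subst Bcontfun_inverse) (auto intro!: bcontfun_normI continuous_intros g(1))
      have norm_f: "norm f \<le> norm x" by (rule norm_bound) (simp only: f gx)
      have sums: "(\<Sum>\<omega>\<in>F. blinfun_apply (z o\<^sub>L m {\<omega>}) (apply_bcontfun f \<omega>))
          = (\<Sum>\<omega>\<in>A \<inter> F. blinfun_apply (z o\<^sub>L m {\<omega>}) x)"
        unfolding f using g(3) F
        by (intro sum.mono_neutral_cong_right) (auto simp: indicator_def)
      have split: "blinfun_apply (z o\<^sub>L m A) x = blinfun_apply (z o\<^sub>L m (A - F)) x
          + (\<Sum>\<omega>\<in>A \<inter> F. blinfun_apply (z o\<^sub>L m {\<omega>}) x)"
        using arg_cong[where f = "\<lambda>\<phi>. blinfun_apply \<phi> x",
            OF finitely_additive_vm_split_finite[OF fa F A]]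
        by (simp only: plus_blinfun.rep_eq blinfun.sum_left)
      have 1: "\<bar>blinfun_apply z (blinfun_apply T f)
          - (\<Sum>\<omega>\<in>A \<inter> F. blinfun_apply (z o\<^sub>L m {\<omega>}) x)\<bar> \<le> norm x * e"
        using near[OF z, of f "norm x"] gx unfolding sums by (simp only: f)
      have 2: "\<bar>blinfun_apply (z o\<^sub>L m (A - F)) x\<bar> \<le> e * norm x"
        using norm_blinfun[of "z o\<^sub>L m (A - F)" x] mult_right_mono[OF off_F norm_ge_zero[of x]]
        unfolding real_norm_def by linarith
      have 3: "\<bar>blinfun_apply z (blinfun_apply T f)\<bar> \<le> norm (z o\<^sub>L T) * norm x"
        using norm_blinfun[of "z o\<^sub>L T" f] mult_left_mono[OF norm_f norm_ge_zero[of "z o\<^sub>L T"]]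
        by simp
      have "\<bar>blinfun_apply (z o\<^sub>L m A) x\<bar> \<le> norm (z o\<^sub>L T) * norm x + e * norm x + norm x * e"
        using 1 2 3 unfolding split by linarith
      then show "norm (blinfun_apply (z o\<^sub>L m A) x) \<le> (norm (z o\<^sub>L T) + 2 * e) * norm x"
        by (simp add: algebra_simps)
    qed
  qed
qed

text \<open>The finite set in the estimates depends on the tolerance only, so it is fixed before \<open>n\<close> tends to
  infinity; in the direction from \<open>m\<close> to \<open>T\<close> only finitely many null sequences are then summed.\<close>

lemma adjoint_tendsto_zero_iff:
  fixes T :: "('o::t2_space \<Rightarrow>\<^sub>C 'x::real_normed_vector) \<Rightarrow>\<^sub>L 'z::real_normed_vector"
    and m :: "'o set \<Rightarrow> 'x \<Rightarrow>\<^sub>L 'z" and \<zeta> :: "nat \<Rightarrow> 'z \<Rightarrow>\<^sub>L real"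
  assumes comp: "compact (UNIV :: 'o set)" and disp: "dispersed TYPE('o)"
    and rep: "representing_measure T (\<lambda>A. bidual_embedding o\<^sub>L m A)"
    and sb: "strongly_bounded m" and bdd: "\<And>n. norm (\<zeta> n) \<le> K"
  shows "(\<lambda>n. norm (\<zeta> n o\<^sub>L T)) \<longlonglongrightarrow> 0 \<longleftrightarrow>
    (\<forall>A\<in>sets borel. (\<lambda>n. norm (\<zeta> n o\<^sub>L m A)) \<longlonglongrightarrow> 0)"
proof (intro iffI ballI)
  fix A :: "'o set"
  assume lim: "(\<lambda>n. norm (\<zeta> n o\<^sub>L T)) \<longlonglongrightarrow> 0" and A: "A \<in> sets borel"
  show "(\<lambda>n. norm (\<zeta> n o\<^sub>L m A)) \<longlonglongrightarrow> 0"
  proof (rule order_tendstoI)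
    fix a :: real assume "0 < a"
    then have a: "0 < a/3" by simp
    have est: "norm (\<zeta> n o\<^sub>L m A) \<le> norm (\<zeta> n o\<^sub>L T) + 2 * (a/3)" for n
      using adjoint_measure_estimates[OF comp disp rep sb a, of K] bdd A by metis
    show "\<forall>\<^sub>F n in sequentially. norm (\<zeta> n o\<^sub>L m A) < a"
      using order_tendstoD(2)[OF lim a]
    proof (rule eventually_mono)
      fix n
      assume "norm (\<zeta> n o\<^sub>L T) < a/3"
      then have "norm (\<zeta> n o\<^sub>L T) + 2 * (a/3) < a" by simp
      then show "norm (\<zeta> n o\<^sub>L m A) < a" by (rule le_less_trans[OF est])
    qed
  qed (simp add: less_le_trans[OF _ norm_ge_zero])
next
  assume lim: "\<forall>A\<in>sets borel. (\<lambda>n. norm (\<zeta> n o\<^sub>L m A)) \<longlonglongrightarrow> 0"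
  show "(\<lambda>n. norm (\<zeta> n o\<^sub>L T)) \<longlonglongrightarrow> 0"
  proof (rule order_tendstoI)
    fix a :: real assume "0 < a"
    then have a: "0 < a/2" by simp
    obtain F where F: "finite F"
        and est: "norm (\<zeta> n o\<^sub>L T) \<le> (\<Sum>\<omega>\<in>F. norm (\<zeta> n o\<^sub>L m {\<omega>})) + a/2" for n
      using adjoint_measure_estimates[OF comp disp rep sb a, of K] bdd by metis
    have "(\<lambda>n. \<Sum>\<omega>\<in>F. norm (\<zeta> n o\<^sub>L m {\<omega>})) \<longlonglongrightarrow> (\<Sum>\<omega>\<in>F. 0)"
      using lim by (intro tendsto_sum) (simp add: finite_set_in_borel)
    then have "\<forall>\<^sub>F n in sequentially. (\<Sum>\<omega>\<in>F. norm (\<zeta> n o\<^sub>L m {\<omega>})) < a/2"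
      using order_tendstoD(2)[OF _ a] by simp
    then show "\<forall>\<^sub>F n in sequentially. norm (\<zeta> n o\<^sub>L T) < a"
    proof (rule eventually_mono)
      fix n
      assume "(\<Sum>\<omega>\<in>F. norm (\<zeta> n o\<^sub>L m {\<omega>})) < a/2"
      then have "(\<Sum>\<omega>\<in>F. norm (\<zeta> n o\<^sub>L m {\<omega>})) + a/2 < a" by simp
      then show "norm (\<zeta> n o\<^sub>L T) < a" by (rule le_less_trans[OF est])
    qed
  qed (simp add: less_le_trans[OF _ norm_ge_zero])
qed

lemma blinfun_compose_id: "S o\<^sub>L id_blinfun = S"
  by (rule blinfun_eqI) simp

text \<open>The map \<open>J\<close> allows both the adjoint itself (\<open>J\<close> the identity of the dual) and its restriction to a
  predual (\<open>J\<close> the canonical embedding).\<close>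

lemma Dunford_Pettis_p_convergent_adjoint_iff:
  fixes T :: "('o::t2_space \<Rightarrow>\<^sub>C 'x::real_normed_vector) \<Rightarrow>\<^sub>L 'z::real_normed_vector"
    and m :: "'o set \<Rightarrow> 'x \<Rightarrow>\<^sub>L 'z"
    and J :: "'w::real_normed_vector \<Rightarrow>\<^sub>L ('z \<Rightarrow>\<^sub>L real)"
  assumes comp: "compact (UNIV :: 'o set)" and disp: "dispersed TYPE('o)"
    and rep: "representing_measure T (\<lambda>A. bidual_embedding o\<^sub>L m A)"
    and sb: "strongly_bounded m"
  shows "Dunford_Pettis_p_convergent p (dual_operator T o\<^sub>L J) \<longleftrightarrow>
    (\<forall>A\<in>sets borel. Dunford_Pettis_p_convergent p (dual_operator (m A) o\<^sub>L J))"
proof -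
  have iff: "(\<lambda>n. norm (blinfun_apply J (w n) o\<^sub>L T)) \<longlonglongrightarrow> 0 \<longleftrightarrow>
      (\<forall>A\<in>sets borel. (\<lambda>n. norm (blinfun_apply J (w n) o\<^sub>L m A)) \<longlonglongrightarrow> 0)"
    if w: "Dunford_Pettis_set (range w)" for w :: "nat \<Rightarrow> 'w"
  proof -
    obtain c where c: "\<And>n. norm (w n) \<le> c"
      using w unfolding Dunford_Pettis_set_def bounded_iff by blast
    have "norm (blinfun_apply J (w n)) \<le> norm J * c" for n
      using norm_blinfun[of J "w n"] mult_left_mono[OF c norm_ge_zero] by (rule order_trans)
    then show ?thesis by (rule adjoint_tendsto_zero_iff[OF comp disp rep sb])
  qed
  show ?thesis
    unfolding Dunford_Pettis_p_convergent_def using iff by auto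
qed

theorem theorem4p10:
  fixes p :: real
  assumes "1 \<le> p"
    and "compact (UNIV :: 'o::t2_space set)"
    and "dispersed TYPE('o)"
  shows
    "(\<forall>(T :: ('o \<Rightarrow>\<^sub>C 'x::banach) \<Rightarrow>\<^sub>L 'y::banach) (m :: 'o set \<Rightarrow> 'x \<Rightarrow>\<^sub>L 'y).
        representing_measure T (\<lambda>A. bidual_embedding o\<^sub>L m A) \<and> strongly_bounded m \<longrightarrow>
        (Dunford_Pettis_p_convergent p (dual_operator T) \<longleftrightarrow>
         (\<forall>A \<in> sets borel. Dunford_Pettis_p_convergent p (dual_operator (m A))))) \<and>
     (\<forall>(T :: ('o \<Rightarrow>\<^sub>C 'x) \<Rightarrow>\<^sub>L ('y \<Rightarrow>\<^sub>L real)) (m :: 'o set \<Rightarrow> 'x \<Rightarrow>\<^sub>L ('y \<Rightarrow>\<^sub>L real)).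
        representing_measure T (\<lambda>A. bidual_embedding o\<^sub>L m A) \<and> strongly_bounded m \<longrightarrow>
        (Dunford_Pettis_p_convergent p (dual_operator T o\<^sub>L bidual_embedding) \<longleftrightarrow>
         (\<forall>A \<in> sets borel.
            Dunford_Pettis_p_convergent p (dual_operator (m A) o\<^sub>L bidual_embedding))))"
proof (intro conjI allI impI)
  fix T :: "('o \<Rightarrow>\<^sub>C 'x) \<Rightarrow>\<^sub>L 'y" and m :: "'o set \<Rightarrow> 'x \<Rightarrow>\<^sub>L 'y"
  assume "representing_measure T (\<lambda>A. bidual_embedding o\<^sub>L m A) \<and> strongly_bounded m"
  then show "Dunford_Pettis_p_convergent p (dual_operator T) \<longleftrightarrow>
      (\<forall>A \<in> sets borel. Dunford_Pettis_p_convergent p (dual_operator (m A)))"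
    using Dunford_Pettis_p_convergent_adjoint_iff[OF assms(2,3), of T m p id_blinfun]
    by (simp only: blinfun_compose_id)
next
  fix T :: "('o \<Rightarrow>\<^sub>C 'x) \<Rightarrow>\<^sub>L ('y \<Rightarrow>\<^sub>L real)" and m :: "'o set \<Rightarrow> 'x \<Rightarrow>\<^sub>L ('y \<Rightarrow>\<^sub>L real)"
  assume "representing_measure T (\<lambda>A. bidual_embedding o\<^sub>L m A) \<and> strongly_bounded m"
  then show "Dunford_Pettis_p_convergent p (dual_operator T o\<^sub>L bidual_embedding) \<longleftrightarrow>
      (\<forall>A \<in> sets borel.
        Dunford_Pettis_p_convergent p (dual_operator (m A) o\<^sub>L bidual_embedding))"
    using Dunford_Pettis_p_convergent_adjoint_iff[OF assms(2,3), of T m p bidual_embedding]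
    by blast
qed

end
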